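(* Let $W$ be a Weyl tensor of Petrov type N, with canonical expression $\mathcal W=\mathcal L\otimes\mathcal L$, where $\mathcal L$ is a (non-zero) null self-dual bivector (the canonical null bivector). Then its Bel-Robinson tensor $T$ admits the canonical expression $$T=\Lambda\otimes\Lambda,\qquad \Lambda=\mathcal L\cdot\overline{\mathcal L}.$$ Associated with the sole (vanishing) eigenvalue of $T$ we have the eight-dimensional eigenspace orthogonal to $\Lambda$.
   Context: $(V,g)$ is an oriented 4-dimensional real vector space with a Lorentzian metric of signature $(-,+,+,+)$ (the tangent space of a space-time at a point); indices are moved with $g$; $\eta$ is the metric volume element; $( *F)_{\alpha\beta}=\frac12\eta_{\alpha\beta\mu\nu}F^{\mu\nu}$, $( *W)_{\alpha\beta\mu\nu}=\frac12\eta_{\alpha\beta}{}^{\rho\sigma}W_{\rho\sigma\mu\nu}$. A self-dual (SD) bivector is a complex 2-form $\mathcal F$ with $*\mathcal F=\mathrm i\mathcal F$; it is null if $\mathcal F_{\alpha\beta}\mathcal F^{\alpha\beta}=0$. A Weyl tensor $W$ is a real 4-tensor with the algebraic symmetries of a Riemann tensor and vanishing traces; $\mathcal W=\frac12(W-\mathrm i*W)$ acts on SD bivectors by $\mathcal W(\mathcal F)_{\alpha\beta}=\frac12\mathcal W_{\alpha\beta}{}^{\mu\nu}\mathcal F_{\mu\nu}$. Type N means that this map is nonzero with vanishing square; it is known that then the canonical expression of the claim exists. The Bel-Robinson (BR) tensor of $W$ is $T_{\alpha\mu\beta\nu}=\mathcal W_{\alpha}{}^{\rho}{}_{\beta}{}^{\sigma}\,\overline{\mathcal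 W}_{\mu\rho\nu\sigma}$; it is totally symmetric and traceless and acts on the 9-dimensional space of traceless symmetric 2-tensors, with metric $(A,B)=A_{\alpha\beta}B^{\alpha\beta}$, by $T(A)_{\alpha\beta}=T_{\alpha\beta}{}^{\mu\nu}A_{\mu\nu}$. For 2-tensors $(A\cdot B)_{\alpha\beta}=A_{\alpha}{}^{\mu}B_{\mu\beta}$. *)

theory Defs
  imports "HOL-Analysis.Analysis"
begin

text \<open>
  Tensors over a 4-dimensional real vector space are given by their covariant components in an
  arbitrary fixed basis, with indices in the four-element type \<^typ>\<open>4\<close>.  The metric has an
  arbitrary component matrix \<open>g\<close>: the basis is not assumed to be orthonormal.
  A tensor \<open>T\<close> has components \<open>T $ a $ b\<close> or \<open>T $ a $ b $ c $ d\<close>.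
\<close>

type_synonym 'a tensor2 = "'a ^ 4 ^ 4"
type_synonym 'a tensor4 = "'a ^ 4 ^ 4 ^ 4 ^ 4"

definition minkowski :: "real tensor2" where
  "minkowski = (\<chi> a b. if a = b then (if a = 0 then -1 else 1) else 0)"

definition lorentzian :: "real tensor2 \<Rightarrow> bool" where
  "lorentzian g \<longleftrightarrow> transpose g = g \<and>
     (\<exists>P :: real ^ 4 ^ 4. invertible P \<and> transpose P ** g ** P = minkowski)"

text \<open>\<open>raise2 g A $ m $ n\<close> is \<open>A\<close> with both indices raised.  Applied to \<open>T $ a $ b\<close> it raises the
  last two indices of a 4-tensor \<open>T\<close>.\<close>

definition raise2 :: "real tensor2 \<Rightarrow> 'a::real_field tensor2 \<Rightarrow> 'a tensor2" where
  "raise2 g A = (\<chi> m n. \<Sum>r\<in>UNIV. \<Sum>s\<in>UNIV.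
     of_real (matrix_inv g $ m $ r) * of_real (matrix_inv g $ n $ s) * A $ r $ s)"

definition inner2 :: "real tensor2 \<Rightarrow> 'a::real_field tensor2 \<Rightarrow> 'a tensor2 \<Rightarrow> 'a" where
  "inner2 g A B = (\<Sum>a\<in>UNIV. \<Sum>b\<in>UNIV. A $ a $ b * raise2 g B $ a $ b)"

definition trace2 :: "real tensor2 \<Rightarrow> 'a::real_field tensor2 \<Rightarrow> 'a" where
  "trace2 g A = (\<Sum>a\<in>UNIV. \<Sum>b\<in>UNIV. of_real (matrix_inv g $ a $ b) * A $ a $ b)"

definition dot2 :: "real tensor2 \<Rightarrow> 'a::real_field tensor2 \<Rightarrow> 'a tensor2 \<Rightarrow> 'a tensor2" where
  "dot2 g A B = (\<chi> a b. \<Sum>m\<in>UNIV. \<Sum>n\<in>UNIV. A $ a $ m * of_real (matrix_inv g $ m $ n) * B $ n $ b)"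

definition tensor_prod :: "'a::times tensor2 \<Rightarrow> 'a tensor2 \<Rightarrow> 'a tensor4" where
  "tensor_prod A B = (\<chi> a b c d. A $ a $ b * B $ c $ d)"

text \<open>\<open>T(A)\<^sub>a\<^sub>b = T\<^sub>a\<^sub>b\<^sup>m\<^sup>n A\<^sub>m\<^sub>n\<close>\<close>

definition act :: "real tensor2 \<Rightarrow> 'a::real_field tensor4 \<Rightarrow> 'a tensor2 \<Rightarrow> 'a tensor2" where
  "act g T A = (\<chi> a b. \<Sum>m\<in>UNIV. \<Sum>n\<in>UNIV. raise2 g (T $ a $ b) $ m $ n * A $ m $ n)"

definition complex2 :: "real tensor2 \<Rightarrow> complex tensor2" where
  "complex2 A = (\<chi> a b. complex_of_real (A $ a $ b))"

definition cnj2 :: "complex tensor2 \<Rightarrow> complex tensor2" where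
  "cnj2 A = (\<chi> a b. cnj (A $ a $ b))"

text \<open>The metric volume element is characterised, up to the sign that encodes the orientation, by
  total antisymmetry and \<open>\<eta>\<^sub>a\<^sub>b\<^sub>c\<^sub>d \<eta>\<^sup>a\<^sup>b\<^sup>c\<^sup>d = - 4!\<close> (the minus sign comes from the Lorentzian signature).
  Choosing one of the two solutions is the same as choosing the orientation.\<close>

definition volume_element :: "real tensor2 \<Rightarrow> real tensor4 \<Rightarrow> bool" where
  "volume_element g \<eta> \<longleftrightarrow>
     (\<forall>a b c d. \<eta> $ a $ b $ c $ d = - \<eta> $ b $ a $ c $ d \<and>
                \<eta> $ a $ b $ c $ d = - \<eta> $ a $ c $ b $ d \<and>
                \<eta> $ a $ b $ c $ d = - \<eta> $ a $ b $ d $ c) \<and>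
     (\<Sum>a\<in>UNIV. \<Sum>b\<in>UNIV. \<Sum>c\<in>UNIV. \<Sum>d\<in>UNIV.
        raise2 g (\<chi> p q. \<eta> $ p $ q $ c $ d) $ a $ b * raise2 g (\<eta> $ a $ b) $ c $ d) = - fact 4"

definition hodge2 :: "real tensor2 \<Rightarrow> real tensor4 \<Rightarrow> complex tensor2 \<Rightarrow> complex tensor2" where
  "hodge2 g \<eta> F = (\<chi> a b. 1 / 2 *
     (\<Sum>m\<in>UNIV. \<Sum>n\<in>UNIV. complex_of_real (\<eta> $ a $ b $ m $ n) * raise2 g F $ m $ n))"

definition hodge4 :: "real tensor2 \<Rightarrow> real tensor4 \<Rightarrow> real tensor4 \<Rightarrow> real tensor4" where
  "hodge4 g \<eta> W = (\<chi> a b m n. 1 / 2 *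
     (\<Sum>r\<in>UNIV. \<Sum>s\<in>UNIV. raise2 g (\<eta> $ a $ b) $ r $ s * W $ r $ s $ m $ n))"

definition sd_bivector :: "real tensor2 \<Rightarrow> real tensor4 \<Rightarrow> complex tensor2 \<Rightarrow> bool" where
  "sd_bivector g \<eta> F \<longleftrightarrow> transpose F = - F \<and> hodge2 g \<eta> F = (\<chi> a b. \<i> * F $ a $ b)"

definition null_bivector :: "real tensor2 \<Rightarrow> complex tensor2 \<Rightarrow> bool" where
  "null_bivector g F \<longleftrightarrow> inner2 g F F = 0"

text \<open>By the algebraic symmetries, the vanishing of the trace over the first and third indices
  makes all traces vanish.\<close>

definition weyl_tensor :: "real tensor2 \<Rightarrow> real tensor4 \<Rightarrow> bool" where
  "weyl_tensor g W \<longleftrightarrow>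
     (\<forall>a b c d. W $ a $ b $ c $ d = - W $ b $ a $ c $ d \<and>
                W $ a $ b $ c $ d = - W $ a $ b $ d $ c \<and>
                W $ a $ b $ c $ d = W $ c $ d $ a $ b \<and>
                W $ a $ b $ c $ d + W $ a $ c $ d $ b + W $ a $ d $ b $ c = 0) \<and>
     (\<forall>b d. trace2 g (\<chi> a c. W $ a $ b $ c $ d) = 0)"

definition sd_weyl :: "real tensor2 \<Rightarrow> real tensor4 \<Rightarrow> real tensor4 \<Rightarrow> complex tensor4" where
  "sd_weyl g \<eta> W = (\<chi> a b c d. 1 / 2 *
     (complex_of_real (W $ a $ b $ c $ d) - \<i> * complex_of_real (hodge4 g \<eta> W $ a $ b $ c $ d)))"

definition sd_weyl_map ::
  "real tensor2 \<Rightarrow> real tensor4 \<Rightarrow> real tensor4 \<Rightarrow> complex tensor2 \<Rightarrow> complex tensor2" where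
  "sd_weyl_map g \<eta> W F = (\<chi> a b. 1 / 2 * act g (sd_weyl g \<eta> W) F $ a $ b)"

definition petrov_type_N :: "real tensor2 \<Rightarrow> real tensor4 \<Rightarrow> real tensor4 \<Rightarrow> bool" where
  "petrov_type_N g \<eta> W \<longleftrightarrow>
     (\<exists>F. sd_bivector g \<eta> F \<and> sd_weyl_map g \<eta> W F \<noteq> 0) \<and>
     (\<forall>F. sd_bivector g \<eta> F \<longrightarrow> sd_weyl_map g \<eta> W (sd_weyl_map g \<eta> W F) = 0)"

text \<open>\<open>T\<^sub>a\<^sub>m\<^sub>b\<^sub>n = \<W>\<^sub>a\<^sup>r\<^sub>b\<^sup>s cnj \<W>\<^sub>m\<^sub>r\<^sub>n\<^sub>s\<close>.  It is kept complex-valued, as the formula gives it; that it is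
  real is not built into the definition.\<close>

definition bel_robinson :: "real tensor2 \<Rightarrow> real tensor4 \<Rightarrow> real tensor4 \<Rightarrow> complex tensor4" where
  "bel_robinson g \<eta> W = (\<chi> a m b n. \<Sum>r\<in>UNIV. \<Sum>s\<in>UNIV.
     raise2 g (\<chi> p q. sd_weyl g \<eta> W $ a $ p $ b $ q) $ r $ s * cnj (sd_weyl g \<eta> W $ m $ r $ n $ s))"

definition traceless_symmetric :: "real tensor2 \<Rightarrow> 'a::real_field tensor2 set" where
  "traceless_symmetric g = {A. transpose A = A \<and> trace2 g A = 0}"

text \<open>Eigenvalues are complex, with eigenvectors in the complexified space.  The eigenspace of a
  real eigenvalue is the set of real eigenvectors (and 0).\<close>

definition eigenvalue_on_ts :: "real tensor2 \<Rightarrow> complex tensor4 \<Rightarrow> complex \<Rightarrow> bool" where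
  "eigenvalue_on_ts g T t \<longleftrightarrow>
     (\<exists>A \<in> traceless_symmetric g. A \<noteq> 0 \<and> act g T A = (\<chi> a b. t * A $ a $ b))"

definition real_eigenspace :: "real tensor2 \<Rightarrow> complex tensor4 \<Rightarrow> real \<Rightarrow> real tensor2 set" where
  "real_eigenspace g T t = {A \<in> traceless_symmetric g. act g T (complex2 A) = complex2 (t *\<^sub>R A)}"

end

theory Submission imports Defs begin

text \<open>
  Contracting \<open>L \<otimes> L\<close> with its conjugate factorises, and antisymmetry of \<open>L\<close> turns the two factors into
  \<open>\<Lambda> = L \<cdot> cnj L\<close>; hence \<open>T(A) = (A,\<Lambda>) \<Lambda>\<close>.  In a frame where \<open>g\<close> is the Minkowski matrix,
  self-duality determines \<open>L\<close> by its electric vector \<open>E\<close>.  There one reads off that \<open>\<Lambda>\<close> is symmetric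
  and traceless (hence real, its transpose being its conjugate), that its time-time component is \<open>-|E|\<^sup>2\<close>,
  and that \<open>(\<Lambda>,\<Lambda>)\<close> is a multiple of \<open>E \<cdot> E\<close>, which vanishes for null \<open>L\<close>.  So \<open>T\<close> is nilpotent and
  its kernel is the hyperplane orthogonal to \<open>\<Lambda>\<close> in the 9-dimensional space of traceless symmetric
  tensors.
\<close>

section \<open>Index enumeration and antisymmetric components\<close>

text \<open>The numeral 4 is 0 in the type \<open>4\<close>, so \<open>sum_4\<close> and
  \<open>forall_4\<close> can be read over 0, 1, 2, 3, with 0 the time index of
  \<open>minkowski\<close>.\<close>

lemma sum_UNIV_4: "(\<Sum>i\<in>UNIV. f (i::4)) = f 0 + f 1 + f 2 + f 3" for f :: "4 \<Rightarrow> 'a::comm_monoid_add"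
proof -
  have [simp]: "(4::4) = 0" by simp
  show ?thesis by (simp add: sum_4 ac_simps)
qed

lemma forall_index_4: "(\<forall>i::4. P i) \<longleftrightarrow> P 0 \<and> P 1 \<and> P 2 \<and> P 3"
proof -
  have [simp]: "(4::4) = 0" by simp
  show ?thesis by (auto simp: forall_4)
qed

lemma eq_minus_self_imp_0: "x = 0" if "x = - x" for x :: "'a::real_field"
proof -
  have "2 * x = 0" using that by (metis mult_2 add.right_inverse)
  then show ?thesis by simp
qed

lemma antisymmetric_nth:
  assumes "transpose A = - A"
  shows "A $ a $ b = - A $ b $ a"
proof -
  have "transpose A $ b $ a = (- A) $ b $ a" by (simp only: assms)
  then show ?thesis by (simp add: transpose_def)
qed

section \<open>Scalar extension of real matrices and the contraction pairing\<close>

text \<open>The target field is left open so that one set of lemmas serves real and complex tensors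
  alike.\<close>

definition real_mat :: "real ^ 4 ^ 4 \<Rightarrow> 'a::real_field ^ 4 ^ 4" where
  "real_mat A = (\<chi> a b. of_real (A $ a $ b))"

text \<open>Bilinear, with no conjugation over the complex numbers: it is the full contraction of a
  covariant with a contravariant tensor.\<close>

definition frob :: "'a::real_field ^ 4 ^ 4 \<Rightarrow> 'a ^ 4 ^ 4 \<Rightarrow> 'a" where
  "frob A B = (\<Sum>a\<in>UNIV. \<Sum>b\<in>UNIV. A $ a $ b * B $ a $ b)"

lemma real_mat_mult: "real_mat (A ** B) = real_mat A ** real_mat B"
  by (simp add: real_mat_def matrix_matrix_mult_def vec_eq_iff)

lemma real_mat_transpose: "real_mat (transpose A) = transpose (real_mat A)"
  by (simp add: real_mat_def transpose_def vec_eq_iff)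

lemma real_mat_one: "real_mat (mat 1) = mat 1"
  by (simp add: real_mat_def mat_def vec_eq_iff)

lemma real_mat_real: "real_mat A = A" for A :: "real ^ 4 ^ 4"
  by (simp add: real_mat_def)

lemma real_mat_complex: "real_mat A = complex2 A"
  by (simp add: real_mat_def complex2_def)

lemma frob_commute: "frob A B = frob B A"
  by (simp add: frob_def mult.commute)

lemma frob_add_right: "frob A (B + C) = frob A B + frob A C"
  by (simp add: frob_def algebra_simps sum.distrib)

lemma frob_scaleR_right: "frob A (c *\<^sub>R B) = of_real c * frob A B"
  by (simp add: frob_def sum_distrib_left scaleR_conv_of_real[where 'a='a] ac_simps)

lemma frob_zero_left: "frob 0 Y = 0"
  by (simp add: frob_def)

lemma frob_add_left: "frob (A + B) Y = frob A Y + frob B Y"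
  by (simp add: frob_commute[of _ Y] frob_add_right)

lemma frob_scaleR_left: "frob (c *\<^sub>R A) Y = of_real c * frob A Y"
  by (simp add: frob_commute[of _ Y] frob_scaleR_right)

lemma frob_sum_left: "frob (\<Sum>i\<in>I. f i) Y = (\<Sum>i\<in>I. frob (f i) Y)"
  by (induction I rule: infinite_finite_induct) (simp_all add: frob_zero_left frob_add_left)

lemma frob_self_eq_0_iff: "frob A A = 0 \<longleftrightarrow> A = 0" for A :: "real ^ 4 ^ 4"
  by (auto simp: frob_def vec_eq_iff sum_nonneg_eq_0_iff sum_nonneg)

lemma frob_mult_left: "frob (A ** B) C = frob B (transpose A ** C)"
proof -
  have "frob (A ** B) C = (\<Sum>a\<in>UNIV. \<Sum>b\<in>UNIV. \<Sum>k\<in>UNIV. A $ a $ k * B $ k $ b * C $ a $ b)"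
    by (simp add: frob_def matrix_matrix_mult_def sum_distrib_right)
  also have "\<dots> = (\<Sum>k\<in>UNIV. \<Sum>b\<in>UNIV. \<Sum>a\<in>UNIV. A $ a $ k * B $ k $ b * C $ a $ b)"
    by (subst sum.swap, subst (2) sum.swap, subst sum.swap) simp
  also have "\<dots> = frob B (transpose A ** C)"
    by (simp add: frob_def matrix_matrix_mult_def transpose_def sum_distrib_left ac_simps)
  finally show ?thesis .
qed

lemma frob_transpose: "frob (transpose A) (transpose B) = frob A B"
  unfolding frob_def transpose_def by (subst sum.swap) simp

lemma frob_mult_right: "frob (A ** B) C = frob A (C ** transpose B)"
proof -
  have "frob (A ** B) C = frob (transpose B ** transpose A) (transpose C)"
    by (metis frob_transpose matrix_transpose_mul)
  also have "\<dots> = frob (transpose A) (transpose (C ** transpose B))"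
    by (simp add: frob_mult_left matrix_transpose_mul)
  finally show ?thesis by (simp add: frob_transpose)
qed

text \<open>Each factor crosses the pairing as its transpose. This is the frame invariance of a
  contraction: a frame change of the covariant argument is absorbed by the contravariant
  one.\<close>

lemma frob_congruence: "frob (transpose Q ** A ** Q) B = frob A (Q ** B ** transpose Q)"
proof -
  have "frob (transpose Q ** A ** Q) B = frob (transpose Q ** A) (B ** transpose Q)"
    by (rule frob_mult_right)
  also have "\<dots> = frob A (Q ** (B ** transpose Q))"
    by (simp add: frob_mult_left)
  finally show ?thesis by (simp add: matrix_mul_assoc)
qed

section \<open>Tensor operations as matrix products\<close>

lemma raise2_eq: "raise2 g A = real_mat (matrix_inv g) ** A ** transpose (real_mat (matrix_inv g))"
proof -
  have "(\<Sum>r\<in>UNIV. \<Sum>s\<in>UNIV. x r * y s * A $ r $ s) = (\<Sum>s\<in>UNIV. (\<Sum>r\<in>UNIV. x r * A $ r $ s) * y s)"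
    for x y :: "4 \<Rightarrow> 'a"
    by (subst sum.swap) (simp add: sum_distrib_right sum_distrib_left ac_simps)
  then show ?thesis
    by (simp add: raise2_def real_mat_def matrix_matrix_mult_def transpose_def vec_eq_iff)
qed

lemma inner2_eq: "inner2 g A B = frob A (raise2 g B)"
  by (simp add: inner2_def frob_def)

lemma trace2_eq: "trace2 g A = frob (real_mat (matrix_inv g)) A"
  by (simp add: trace2_def frob_def real_mat_def)

lemma dot2_eq: "dot2 g A B = A ** real_mat (matrix_inv g) ** B"
  unfolding dot2_def real_mat_def matrix_matrix_mult_def vec_eq_iff
  by (simp add: sum_distrib_right) (subst sum.swap, simp)

lemma hodge2_eq: "hodge2 g \<eta> F $ a $ b = frob (real_mat (\<eta> $ a $ b)) (raise2 g F) / 2"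
  by (simp add: hodge2_def frob_def real_mat_def)

section \<open>The Minkowski matrix and the inverse metric\<close>

lemma minkowski_mult_self: "minkowski ** minkowski = mat 1"
  by (simp add: minkowski_def matrix_matrix_mult_def mat_def vec_eq_iff forall_index_4 sum_UNIV_4)

lemma transpose_minkowski: "transpose minkowski = minkowski"
  by (auto simp: minkowski_def transpose_def vec_eq_iff)

lemma minkowski_mult_left: "(real_mat minkowski ** A) $ a $ b = (if a = 0 then - (A $ a $ b) else A $ a $ b)"
  by (simp add: real_mat_def minkowski_def matrix_matrix_mult_def if_distrib[of of_real]
      if_distrib[of "\<lambda>x. x * _"] cong: if_cong)

lemma minkowski_mult_right: "(A ** real_mat minkowski) $ a $ b = (if b = 0 then - (A $ a $ b) else A $ a $ b)"
  by (simp add: real_mat_def minkowski_def matrix_matrix_mult_def if_distrib[of of_real]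
      if_distrib[of "\<lambda>x. _ * x"] cong: if_cong)

lemma matrix_inv_inverse:
  assumes "invertible A"
  shows "A ** matrix_inv A = mat 1" "matrix_inv A ** A = mat 1"
  using someI_ex[OF assms[unfolded invertible_def]] by (simp_all add: matrix_inv_def)

lemma transpose_matrix_inv:
  fixes g :: "real ^ 4 ^ 4"
  assumes "invertible g" "transpose g = g"
  shows "transpose (matrix_inv g) = matrix_inv g"
proof -
  have "transpose (matrix_inv g) ** g = transpose (g ** matrix_inv g)"
    by (simp add: matrix_transpose_mul assms(2))
  also have "\<dots> = mat 1" by (simp add: matrix_inv_inverse[OF assms(1)])
  finally have left: "transpose (matrix_inv g) ** g = mat 1" .
  have "transpose (matrix_inv g) = transpose (matrix_inv g) ** (g ** matrix_inv g)"
    by (simp add: matrix_inv_inverse[OF assms(1)])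
  also have "\<dots> = matrix_inv g"
    by (simp add: matrix_mul_assoc left)
  finally show ?thesis .
qed

lemma matrix_inv_nth_commute:
  fixes g :: "real ^ 4 ^ 4"
  assumes "invertible g" "transpose g = g"
  shows "matrix_inv g $ a $ b = matrix_inv g $ b $ a"
proof -
  have "transpose (matrix_inv g) $ a $ b = matrix_inv g $ a $ b"
    by (simp only: transpose_matrix_inv[OF assms])
  then show ?thesis by (simp add: transpose_def)
qed

text \<open>The columns of \<open>P\<close> form an orthonormal frame. As \<open>minkowski\<close>
  is its own inverse, inverting the congruence expresses the inverse metric through \<open>P\<close>
  alone.\<close>

lemma lorentzian_frame:
  assumes "invertible P" "transpose P ** g ** P = minkowski"
  shows "invertible g" "matrix_inv g = P ** minkowski ** transpose P"
proof -
  have P: "P ** matrix_inv P = mat 1" "matrix_inv P ** P = mat 1"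
    using assms(1) by (simp_all add: matrix_inv_inverse)
  \<comment> \<open>Inserting \<open>transpose (matrix_inv P) ** transpose P\<close>, the identity,
    on the left makes \<open>transpose P ** g ** P\<close> appear.\<close>
  have "g ** (P ** minkowski ** transpose P) =
      (transpose (matrix_inv P) ** transpose P) ** g ** P ** minkowski ** transpose P"
    by (simp add: P matrix_transpose_mul[symmetric] matrix_mul_assoc)
  also have "\<dots> = transpose (matrix_inv P) ** (transpose P ** g ** P) ** minkowski ** transpose P"
    by (simp add: matrix_mul_assoc)
  also have "\<dots> = transpose (matrix_inv P) ** (minkowski ** minkowski) ** transpose P"
    by (simp add: assms(2) matrix_mul_assoc)
  also have "\<dots> = mat 1"
    by (simp add: minkowski_mult_self matrix_transpose_mul[symmetric] P)
  finally have r: "g ** (P ** minkowski ** transpose P) = mat 1" .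
  then have l: "(P ** minkowski ** transpose P) ** g = mat 1"
    by (simp add: matrix_left_right_inverse)
  show "invertible g" using l r invertible_def by blast
  then have "matrix_inv g ** g = mat 1" by (simp add: matrix_inv_inverse)
  then show "matrix_inv g = P ** minkowski ** transpose P"
    by (metis r matrix_mul_assoc matrix_mul_lid matrix_mul_rid)
qed

section \<open>Self-dual bivectors in an orthonormal frame\<close>

text \<open>Total antisymmetry leaves one independent component \<open>s\<close> of \<epsilon>, so
  duality couples each electric component of \<open>X\<close> with one magnetic component. The
  factor \<open>t\<close> is \<open>\<i> * s\<close> with \<open>s\<close> equal to 1 or -1, which
  covers both orientations.\<close>

lemma minkowski_self_dual_components:
  fixes X :: "complex tensor2"
  assumes anti: "\<And>a b c d. (\<epsilon> :: complex tensor4) $ a $ b $ c $ d = - \<epsilon> $ b $ a $ c $ d"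
      "\<And>a b c d. \<epsilon> $ a $ b $ c $ d = - \<epsilon> $ a $ c $ b $ d"
      "\<And>a b c d. \<epsilon> $ a $ b $ c $ d = - \<epsilon> $ a $ b $ d $ c"
    and X: "transpose X = - X"
    and dual: "\<And>a b. \<i> * X $ a $ b = frob (\<epsilon> $ a $ b) (real_mat minkowski ** X ** real_mat minkowski) / 2"
    and "X \<noteq> 0"
  obtains t where "t * t = -1" "cnj t = - t"
    "X $ 2 $ 3 = t * X $ 0 $ 1" "X $ 3 $ 1 = t * X $ 0 $ 2" "X $ 1 $ 2 = t * X $ 0 $ 3"
proof -
  note Xa = antisymmetric_nth[OF X]
  have Xd: "X $ a $ a = 0" for a
    by (rule eq_minus_self_imp_0) (rule Xa)
  \<comment> \<open>A repeated index kills the component. Adjacent positions give this at once; the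
    other three cases are reduced to these by a transposition.\<close>
  have z: "\<epsilon> $ a $ a $ c $ d = 0" "\<epsilon> $ a $ c $ c $ d = 0" "\<epsilon> $ a $ b $ c $ c = 0"
    "\<epsilon> $ a $ c $ a $ d = 0" "\<epsilon> $ a $ b $ d $ b = 0" "\<epsilon> $ a $ c $ d $ a = 0" for a b c d
  proof -
    show 1: "\<epsilon> $ a $ a $ c $ d = 0" for a c d by (rule eq_minus_self_imp_0) (rule anti)
    show 2: "\<epsilon> $ a $ c $ c $ d = 0" for a c d by (rule eq_minus_self_imp_0) (rule anti)
    show "\<epsilon> $ a $ b $ c $ c = 0" by (rule eq_minus_self_imp_0) (rule anti)
    show 4: "\<epsilon> $ a $ c $ a $ d = 0" for a c d using anti(2)[of a c a d] 1[of a c d] by simp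
    show "\<epsilon> $ a $ b $ d $ b = 0" using anti(3)[of a b d b] 2[of a b d] by simp
    show "\<epsilon> $ a $ c $ d $ a = 0" using anti(3)[of a c d a] 4[of a c d] by simp
  qed
  define s where "s = \<epsilon> $ 0 $ 1 $ 2 $ 3"
  have e: "\<epsilon> $ 0 $ 1 $ 2 $ 3 = s" "\<epsilon> $ 0 $ 1 $ 3 $ 2 = - s"
    "\<epsilon> $ 0 $ 2 $ 1 $ 3 = - s" "\<epsilon> $ 0 $ 2 $ 3 $ 1 = s"
    "\<epsilon> $ 0 $ 3 $ 1 $ 2 = s" "\<epsilon> $ 0 $ 3 $ 2 $ 1 = - s"
    using anti(2)[of 0 2 1 3] anti(3)[of 0 1 3 2] anti(3)[of 0 2 3 1]
      anti(2)[of 0 3 1 2] anti(3)[of 0 3 2 1]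
    by (simp_all add: s_def)
  have e': "\<epsilon> $ 2 $ 3 $ 0 $ 1 = s" "\<epsilon> $ 2 $ 3 $ 1 $ 0 = - s"
    "\<epsilon> $ 3 $ 1 $ 0 $ 2 = s" "\<epsilon> $ 3 $ 1 $ 2 $ 0 = - s"
    "\<epsilon> $ 1 $ 2 $ 0 $ 3 = s" "\<epsilon> $ 1 $ 2 $ 3 $ 0 = - s"
    using anti(3)[of 2 3 1 0] anti(2)[of 2 3 0 1] anti(1)[of 2 0 3 1] e
     anti(3)[of 3 1 2 0] anti(2)[of 3 1 0 2] anti(1)[of 3 0 1 2]
     anti(3)[of 1 2 3 0] anti(2)[of 1 2 0 3] anti(1)[of 1 0 2 3]
    by simp_all
  note D = frob_def sum_UNIV_4 minkowski_mult_left minkowski_mult_right z e e'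
  \<comment> \<open>The minus signs in the second row come from raising one time index of
    \<open>X\<close>.\<close>
  have d1: "\<i> * X $ 0 $ 1 = s * X $ 2 $ 3" "\<i> * X $ 0 $ 2 = s * X $ 3 $ 1" "\<i> * X $ 0 $ 3 = s * X $ 1 $ 2"
    "\<i> * X $ 2 $ 3 = - s * X $ 0 $ 1" "\<i> * X $ 3 $ 1 = - s * X $ 0 $ 2" "\<i> * X $ 1 $ 2 = - s * X $ 0 $ 3"
    using Xa[of 3 2] Xa[of 1 3] Xa[of 2 1] Xa[of 1 0] Xa[of 2 0] Xa[of 3 0]
    by (simp_all add: dual D)
  \<comment> \<open>Dualising twice multiplies a component of \<open>X\<close> by \<open>- s * s\<close>, but also by \<open>\<i> * \<i>\<close>.\<close>
  have "s * s = 1"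
  proof (rule ccontr)
    assume ns: "s * s \<noteq> 1"
    have *: "x = 0 \<and> y = 0" if "\<i> * x = s * y" "\<i> * y = - s * x" for x y
    proof -
      have "\<i> * (\<i> * x) = s * (\<i> * y)" unfolding that(1) by simp
      then have "(s * s - 1) * x = 0" by (simp add: that(2) algebra_simps)
      moreover have "\<i> * (\<i> * y) = - s * (\<i> * x)" unfolding that(2) by simp
      then have "(s * s - 1) * y = 0" by (simp add: that(1) algebra_simps)
      ultimately show ?thesis using ns by simp
    qed
    have "X $ a $ b = 0" for a b
    proof -
      have "\<forall>a b. X $ a $ b = 0"
        using *[OF d1(1,4)] *[OF d1(2,5)] *[OF d1(3,6)]
          Xa[of 3 2] Xa[of 1 3] Xa[of 2 1] Xa[of 1 0] Xa[of 2 0] Xa[of 3 0]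
        by (simp add: forall_index_4 Xd)
      then show ?thesis by simp
    qed
    with \<open>X \<noteq> 0\<close> show False by (simp add: vec_eq_iff)
  qed
  then have s: "s = 1 \<or> s = -1"
    using square_eq_1_iff by blast
  show thesis
  proof (rule that[of "\<i> * s"])
    show "\<i> * s * (\<i> * s) = - 1" "cnj (\<i> * s) = - (\<i> * s)" using s by auto
    show "X $ 2 $ 3 = \<i> * s * X $ 0 $ 1" "X $ 3 $ 1 = \<i> * s * X $ 0 $ 2" "X $ 1 $ 2 = \<i> * s * X $ 0 $ 3"
      using s by (elim disjE; simp add: d1)+
  qed
qed

lemma minkowski_self_dual_square:
  fixes X :: "complex tensor2"
  assumes t: "t * t = -1" "cnj t = - t"
    and X: "transpose X = - X"
    and sd: "X $ 2 $ 3 = t * X $ 0 $ 1" "X $ 3 $ 1 = t * X $ 0 $ 2" "X $ 1 $ 2 = t * X $ 0 $ 3"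
  defines "\<Lambda> \<equiv> X ** real_mat minkowski ** cnj2 X"
  shows "transpose \<Lambda> = \<Lambda>" "frob (real_mat minkowski) \<Lambda> = 0"
    "\<Lambda> = 0 \<Longrightarrow> X = 0"
    "frob X (real_mat minkowski ** X ** real_mat minkowski) = 0 \<Longrightarrow>
      frob \<Lambda> (real_mat minkowski ** \<Lambda> ** real_mat minkowski) = 0"
proof -
  note Xa = antisymmetric_nth[OF X]
  have Xd: "X $ a $ a = 0" for a
    by (rule eq_minus_self_imp_0) (rule Xa)
  \<comment> \<open>The electric vector \<open>(u, v, w)\<close> and its conjugate \<open>(p, q, r)\<close>: up to a factor, \<open>\<Lambda>\<close> is the
      stress-energy tensor of \<open>X\<close>, whose energy density vanishes only for \<open>X = 0\<close>.\<close>
  define u v w where uvw: "u = X $ 0 $ 1" "v = X $ 0 $ 2" "w = X $ 0 $ 3"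
  have c: "X $ 0 $ 1 = u" "X $ 0 $ 2 = v" "X $ 0 $ 3 = w" "X $ 1 $ 0 = - u" "X $ 2 $ 0 = - v" "X $ 3 $ 0 = - w"
    "X $ 2 $ 3 = t * u" "X $ 3 $ 1 = t * v" "X $ 1 $ 2 = t * w" "X $ 3 $ 2 = - t * u" "X $ 1 $ 3 = - t * v" "X $ 2 $ 1 = - t * w"
    using sd Xa[of 2 3] Xa[of 3 1] Xa[of 1 2] Xa[of 0 1] Xa[of 0 2] Xa[of 0 3] by (simp_all add: uvw)
  note D = frob_def sum_UNIV_4 minkowski_mult_left minkowski_mult_right
  \<comment> \<open>Naming the conjugates makes the identities below polynomial in six independent
    variables and \<open>t\<close>.\<close>
  define p q r where pqr: "p = cnj u" "q = cnj v" "r = cnj w"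
  have tt: "t * (t * z) = - z" for z using t(1) by algebra
  \<comment> \<open>With E = (u, v, w) and its conjugate F = (p, q, r): the time-time entry is -E.F,
    the mixed entries are those of t (E x F), and the spatial block is E_i F_j + E_j F_i minus E.F
    times the identity.\<close>
  have L: "\<Lambda> $ 0 $ 0 = - (u * p + v * q + w * r)"
    "\<Lambda> $ 0 $ 1 = t * (v * r - w * q)" "\<Lambda> $ 1 $ 0 = t * (v * r - w * q)"
    "\<Lambda> $ 0 $ 2 = t * (w * p - u * r)" "\<Lambda> $ 2 $ 0 = t * (w * p - u * r)"
    "\<Lambda> $ 0 $ 3 = t * (u * q - v * p)" "\<Lambda> $ 3 $ 0 = t * (u * q - v * p)"
    "\<Lambda> $ 1 $ 1 = u * p - v * q - w * r" "\<Lambda> $ 2 $ 2 = v * q - u * p - w * r" "\<Lambda> $ 3 $ 3 = w * r - u * p - v * q"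
    "\<Lambda> $ 1 $ 2 = u * q + v * p" "\<Lambda> $ 2 $ 1 = u * q + v * p"
    "\<Lambda> $ 1 $ 3 = u * r + w * p" "\<Lambda> $ 3 $ 1 = u * r + w * p"
    "\<Lambda> $ 2 $ 3 = v * r + w * q" "\<Lambda> $ 3 $ 2 = v * r + w * q"
    unfolding \<Lambda>_def matrix_matrix_mult_def[of "X ** _"]
    by (simp_all add: D cnj2_def c Xd t(2) pqr tt algebra_simps)
  show "transpose \<Lambda> = \<Lambda>"
    by (simp add: transpose_def vec_eq_iff forall_index_4 L)
  show "frob (real_mat minkowski) \<Lambda> = 0"
    by (simp add: frob_def sum_UNIV_4 real_mat_def minkowski_def L)
  show "X = 0" if "\<Lambda> = 0"
  proof -
    have "u * cnj u + v * cnj v + w * cnj w = 0" using L(1) unfolding that pqr by (metis minus_equation_iff minus_zero zero_index)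
    then have "complex_of_real ((cmod u)\<^sup>2 + (cmod v)\<^sup>2 + (cmod w)\<^sup>2) = 0"
      by (simp add: complex_norm_square del: of_real_power)
    then have "(cmod u)\<^sup>2 + (cmod v)\<^sup>2 + (cmod w)\<^sup>2 = 0" using of_real_eq_0_iff by blast
    then have "u = 0 \<and> v = 0 \<and> w = 0"
      by (smt (verit) norm_eq_zero zero_le_power2 power_eq_0_iff)
    then show ?thesis by (simp add: vec_eq_iff forall_index_4 c Xd)
  qed
  show "frob \<Lambda> (real_mat minkowski ** \<Lambda> ** real_mat minkowski) = 0"
    if n: "frob X (real_mat minkowski ** X ** real_mat minkowski) = 0"
  proof -
    \<comment> \<open>The electric and the magnetic entries contribute -2 E.E each, the latter
      because \<open>t * t = -1\<close>.\<close>
    have "-4 * (u * u + v * v + w * w) = frob X (real_mat minkowski ** X ** real_mat minkowski)"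
      by (simp add: D c Xd) (use t(1) in algebra)
    then have "u * u + v * v + w * w = 0" unfolding n mult_eq_0_iff by simp
    \<comment> \<open>Lagrange's identity turns the square of the cross product E x F into
      (E.E)(F.F) - (E.F)^2; then all terms in (E.F)^2 cancel.\<close>
    moreover have "frob \<Lambda> (real_mat minkowski ** \<Lambda> ** real_mat minkowski) = 4 * (u * u + v * v + w * w) * (p * p + q * q + r * r)"
      by (simp add: D L) (use t(1) in algebra)
    ultimately show ?thesis by simp
  qed
qed

section \<open>Dimension counts for symmetric tensors\<close>

lemma subspace_kernel:
  fixes f :: "'a::euclidean_space \<Rightarrow> real"
  assumes "subspace S" "linear f"
  shows "subspace {y \<in> S. f y = 0}"
  using assms by (auto simp: subspace_def linear_0 linear_add linear_scale)

text \<open>The vector \<open>x\<close> spans a complement of the kernel in \<open>S\<close>. Every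
  dimension below is obtained by cutting with one functional at a time, each with an explicit
  witness \<open>x\<close>.\<close>

lemma dim_kernel:
  fixes f :: "'a::euclidean_space \<Rightarrow> real"
  assumes S: "subspace S" and f: "linear f" and x: "x \<in> S" "f x \<noteq> 0"
  shows "dim S = Suc (dim {y \<in> S. f y = 0})"
proof -
  let ?K = "{y \<in> S. f y = 0}"
  have K: "span ?K = ?K"
    using subspace_kernel[OF S f] by (simp add: span_eq_iff)
  have "S \<subseteq> span (insert x ?K)"
  proof
    fix y assume y: "y \<in> S"
    \<comment> \<open>The coefficient for which \<open>y - ?c *\<^sub>R x\<close> lies in the
      kernel.\<close>
    let ?c = "f y / f x"
    have "y - ?c *\<^sub>R x \<in> ?K"
      using S f x y by (auto simp: linear_diff linear_scale intro: subspace_diff subspace_scale)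
    then show "y \<in> span (insert x ?K)"
      by (auto simp: span_insert K)
  qed
  moreover have "span (insert x ?K) \<subseteq> S"
    using S x by (intro span_minimal) auto
  ultimately have "dim S = dim (insert x ?K)"
    by (metis dim_span subset_antisym)
  moreover have "x \<notin> span ?K" unfolding K using x by simp
  ultimately show ?thesis by (simp add: dim_insert)
qed

text \<open>Each pair in \<open>I\<close> imposes one new independent equation. The hypothesis
  excludes diagonal pairs and a pair listed together with its reverse, whose equations would be
  redundant.\<close>

lemma dim_partially_symmetric:
  fixes I :: "(4 \<times> 4) set"
  assumes "finite I" "\<forall>(i,j)\<in>I. (j,i) \<notin> I"
  shows "subspace {A :: real ^ 4 ^ 4. \<forall>(i,j)\<in>I. A $ i $ j = A $ j $ i} \<and>
    dim {A :: real ^ 4 ^ 4. \<forall>(i,j)\<in>I. A $ i $ j = A $ j $ i} + card I = 16"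
  using assms
proof (induction I rule: finite_induct)
  case empty
  show ?case by simp
next
  case (insert p I)
  obtain i j where p: "p = (i, j)" by fastforce
  let ?S = "{A :: real ^ 4 ^ 4. \<forall>(i,j)\<in>I. A $ i $ j = A $ j $ i}"
  let ?f = "\<lambda>A :: real ^ 4 ^ 4. A $ i $ j - A $ j $ i"
  \<comment> \<open>This matrix unit violates the new equation but satisfies the old ones, since
    neither \<open>(i, j)\<close> nor \<open>(j, i)\<close> is in \<open>I\<close>.\<close>
  let ?E = "\<chi> a b. if a = i \<and> b = j then (1::real) else 0"
  have IH: "subspace ?S" "dim ?S + card I = 16" using insert by auto
  have f: "linear ?f" by (rule linearI) (auto simp: algebra_simps)
  have ne: "i \<noteq> j" "(j, i) \<notin> I" using insert.prems p by auto
  have E: "?E \<in> ?S" using ne insert.hyps p by auto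
  have fE: "?f ?E \<noteq> 0" using ne by auto
  have eq: "{A :: real ^ 4 ^ 4. \<forall>(i,j)\<in>insert p I. A $ i $ j = A $ j $ i} = {A \<in> ?S. ?f A = 0}"
    by (auto simp: p)
  show ?case
    unfolding eq using dim_kernel[OF IH(1) f E fE] subspace_kernel[OF IH(1) f] IH(2) insert.hyps by simp
qed

lemma dim_symmetric:
  "subspace {A :: real ^ 4 ^ 4. transpose A = A}" "dim {A :: real ^ 4 ^ 4. transpose A = A} = 10"
proof -
  let ?I = "{(0,1),(0,2),(0,3),(1,2),(1,3),(2,3)} :: (4 \<times> 4) set"
  have eq: "{A :: real ^ 4 ^ 4. transpose A = A} = {A. \<forall>(i,j)\<in>?I. A $ i $ j = A $ j $ i}"
    by (auto simp: transpose_def vec_eq_iff forall_index_4)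
  have "subspace {A :: real ^ 4 ^ 4. \<forall>(i,j)\<in>?I. A $ i $ j = A $ j $ i} \<and>
     dim {A :: real ^ 4 ^ 4. \<forall>(i,j)\<in>?I. A $ i $ j = A $ j $ i} + card ?I = 16"
    by (rule dim_partially_symmetric) auto
  then show "subspace {A :: real ^ 4 ^ 4. transpose A = A}" "dim {A :: real ^ 4 ^ 4. transpose A = A} = 10"
    unfolding eq by auto
qed

lemma inner2_commute:
  assumes "invertible g" "transpose g = g"
  shows "inner2 g A B = inner2 g B A"
proof -
  have G: "transpose (real_mat (matrix_inv g)) = (real_mat (matrix_inv g) :: 'a ^ 4 ^ 4)"
    by (simp add: real_mat_transpose[symmetric] transpose_matrix_inv[OF assms])
  show ?thesis
    using frob_congruence[of "real_mat (matrix_inv g)" A B]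
    by (simp add: inner2_eq raise2_eq G frob_commute)
qed

text \<open>Two cuts lead from 10 to 9 to 8: the trace is nonzero on \<open>g\<close>, and pairing
  with \<Lambda> is nonzero on the traceless symmetric tensors by nondegeneracy. As \<Lambda> may be
  null, it cannot serve as its own witness.\<close>

lemma dim_orthogonal_traceless_symmetric:
  assumes g: "invertible g" "transpose g = g" and \<Lambda>: "\<Lambda> \<in> traceless_symmetric g" "\<Lambda> \<noteq> 0"
  shows "dim {A \<in> traceless_symmetric g. inner2 g \<Lambda> A = (0::real)} = 8"
proof -
  let ?G = "matrix_inv g"
  let ?Sym = "{A :: real ^ 4 ^ 4. transpose A = A}"
  have G: "transpose ?G = ?G" by (rule transpose_matrix_inv[OF g])
  have Gg: "?G ** g = mat 1" "g ** ?G = mat 1" using matrix_inv_inverse[OF g(1)] by auto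
  have tr: "trace2 g A = frob ?G A" for A :: "real ^ 4 ^ 4"
    by (simp add: trace2_eq real_mat_real)
  have inn: "inner2 g \<Lambda> A = frob \<Lambda> (?G ** A ** ?G)" for A
    by (simp add: inner2_eq raise2_eq real_mat_real G)
  have lin_tr: "linear (trace2 g :: real tensor2 \<Rightarrow> real)"
    by (rule linearI) (simp_all add: tr frob_add_right frob_scaleR_right)
  have "inner2 g \<Lambda> A = frob (?G ** \<Lambda> ** ?G) A" for A
    using frob_congruence[of ?G \<Lambda> A] by (simp add: inn G)
  then have lin_inn: "linear (inner2 g \<Lambda>)"
    by (intro linearI) (simp_all add: frob_add_right frob_scaleR_right)
  have trg: "trace2 g g = (4::real)"
  proof -
    have "trace2 g g = frob (mat 1 ** ?G) g" by (simp add: tr)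
    also have "\<dots> = frob (mat 1) (g ** ?G)" by (subst frob_mult_right) (simp add: G)
    also have "\<dots> = 4" by (simp add: Gg frob_def mat_def sum_UNIV_4)
    finally show ?thesis .
  qed
  have ts: "traceless_symmetric g = {A \<in> ?Sym. trace2 g A = (0::real)}"
    by (auto simp: traceless_symmetric_def)
  have d9: "dim (traceless_symmetric g :: real tensor2 set) = 9"
    using dim_kernel[OF dim_symmetric(1) lin_tr, of g] g(2) trg dim_symmetric(2) unfolding ts by simp
  have sub: "subspace (traceless_symmetric g :: real tensor2 set)"
    unfolding ts by (rule subspace_kernel[OF dim_symmetric(1) lin_tr])
  \<comment> \<open>The trace-free part of \<open>\<Lambda>\<close> read as a contravariant tensor: it pairs with \<open>\<Lambda>\<close> to the Euclidean
      square norm of the components.\<close>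
  define B where "B = g ** \<Lambda> ** g"
  define A where "A = B - (trace2 g B / 4) *\<^sub>R g"
  have B_sym: "transpose B = B"
    using \<Lambda>(1) g(2) by (simp add: B_def traceless_symmetric_def matrix_transpose_mul matrix_mul_assoc)
  have "transpose A = A"
  proof -
    have "transpose (B - c *\<^sub>R g) = transpose B - c *\<^sub>R transpose g" for c
      by (simp add: transpose_def vec_eq_iff)
    then show ?thesis by (simp add: A_def B_sym g(2))
  qed
  moreover have "trace2 g A = 0"
    by (simp add: A_def linear_diff[OF lin_tr] linear_scale[OF lin_tr] trg)
  ultimately have A_ts: "A \<in> traceless_symmetric g"
    by (simp add: traceless_symmetric_def)
  \<comment> \<open>Pairing with \<open>g\<close> is the trace of \<Lambda>, so removing the trace
    of \<open>B\<close> does not change its pairing with \<Lambda>.\<close>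
  have "inner2 g \<Lambda> g = 0"
    using \<Lambda>(1) frob_commute[of \<Lambda> ?G] by (simp add: inn Gg traceless_symmetric_def tr)
  moreover have "?G ** B ** ?G = (?G ** g) ** \<Lambda> ** (g ** ?G)"
    by (simp add: B_def matrix_mul_assoc)
  then have "inner2 g \<Lambda> B = frob \<Lambda> \<Lambda>"
    by (simp add: inn Gg)
  ultimately have "inner2 g \<Lambda> A = frob \<Lambda> \<Lambda>"
    by (simp add: A_def linear_diff[OF lin_inn] linear_scale[OF lin_inn])
  then have "inner2 g \<Lambda> A \<noteq> 0" using \<Lambda>(2) by (simp add: frob_self_eq_0_iff)
  then show ?thesis
    using dim_kernel[OF sub lin_inn A_ts] d9 by simp
qed

section \<open>Transport to an orthonormal frame\<close>

lemma congruence_nth: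
  "(transpose Q ** A ** Q) $ a $ b = (\<Sum>r\<in>UNIV. \<Sum>s\<in>UNIV. Q $ r $ a * Q $ s $ b * A $ r $ s)"
  for A :: "'a::real_field ^ 4 ^ 4"
proof -
  have "(transpose Q ** A ** Q) $ a $ b = (\<Sum>s\<in>UNIV. \<Sum>r\<in>UNIV. Q $ r $ a * Q $ s $ b * A $ r $ s)"
    by (simp add: matrix_matrix_mult_def transpose_def sum_distrib_right sum_distrib_left ac_simps)
  also have "\<dots> = (\<Sum>r\<in>UNIV. \<Sum>s\<in>UNIV. Q $ r $ a * Q $ s $ b * A $ r $ s)"
    by (rule sum.swap)
  finally show ?thesis .
qed

text \<open>The frame components of a 4-tensor, with the last two indices transformed by a matrix
  congruence. Complex values allow \<open>frob\<close> to pair them with complex bivectors.\<close>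

definition frame4 :: "real ^ 4 ^ 4 \<Rightarrow> real tensor4 \<Rightarrow> complex tensor4" where
  "frame4 P \<eta> = (\<chi> a b. \<Sum>p\<in>UNIV. \<Sum>q\<in>UNIV.
     (P $ p $ a * P $ q $ b) *\<^sub>R (transpose (real_mat P) ** real_mat (\<eta> $ p $ q) ** real_mat P))"

lemma frame4_nth:
  "frame4 P \<eta> $ a $ b $ c $ d = complex_of_real (\<Sum>p\<in>UNIV. \<Sum>q\<in>UNIV. \<Sum>r\<in>UNIV. \<Sum>s\<in>UNIV.
     P $ p $ a * P $ q $ b * P $ r $ c * P $ s $ d * \<eta> $ p $ q $ r $ s)"
  by (simp add: frame4_def congruence_nth)
     (simp add: real_mat_def scaleR_conv_of_real sum_distrib_left ac_simps)

text \<open>Exchanging two adjacent summations and applying the antisymmetry of \<eta> to the summed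
  indices exchanges the frame indices.\<close>

lemma frame4_antisymmetric:
  assumes "\<And>a b c d. \<eta> $ a $ b $ c $ d = - \<eta> $ b $ a $ c $ d"
    "\<And>a b c d. \<eta> $ a $ b $ c $ d = - \<eta> $ a $ c $ b $ d"
    "\<And>a b c d. \<eta> $ a $ b $ c $ d = - \<eta> $ a $ b $ d $ c"
  shows "frame4 P \<eta> $ a $ b $ c $ d = - frame4 P \<eta> $ b $ a $ c $ d"
    "frame4 P \<eta> $ a $ b $ c $ d = - frame4 P \<eta> $ a $ c $ b $ d"
    "frame4 P \<eta> $ a $ b $ c $ d = - frame4 P \<eta> $ a $ b $ d $ c"
proof -
  let ?S = "\<lambda>a b c d. \<Sum>p\<in>UNIV. \<Sum>q\<in>UNIV. \<Sum>r\<in>UNIV. \<Sum>s\<in>UNIV.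
     P $ p $ a * P $ q $ b * P $ r $ c * P $ s $ d * \<eta> $ p $ q $ r $ s"
  have "?S a b c d = (\<Sum>q\<in>UNIV. \<Sum>p\<in>UNIV. \<Sum>r\<in>UNIV. \<Sum>s\<in>UNIV.
     P $ p $ a * P $ q $ b * P $ r $ c * P $ s $ d * \<eta> $ p $ q $ r $ s)"
    by (rule sum.swap)
  also have "\<dots> = - ?S b a c d"
    unfolding sum_negf[symmetric] by (intro sum.cong refl) (subst assms(1), simp)
  finally show "frame4 P \<eta> $ a $ b $ c $ d = - frame4 P \<eta> $ b $ a $ c $ d"
    unfolding frame4_nth by simp
  have "?S a b c d = (\<Sum>p\<in>UNIV. \<Sum>r\<in>UNIV. \<Sum>q\<in>UNIV. \<Sum>s\<in>UNIV.
     P $ p $ a * P $ q $ b * P $ r $ c * P $ s $ d * \<eta> $ p $ q $ r $ s)"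
    by (intro sum.cong refl sum.swap)
  also have "\<dots> = - ?S a c b d"
    unfolding sum_negf[symmetric] by (intro sum.cong refl) (subst assms(2), simp)
  finally show "frame4 P \<eta> $ a $ b $ c $ d = - frame4 P \<eta> $ a $ c $ b $ d"
    unfolding frame4_nth by simp
  have "?S a b c d = (\<Sum>p\<in>UNIV. \<Sum>q\<in>UNIV. \<Sum>s\<in>UNIV. \<Sum>r\<in>UNIV.
     P $ p $ a * P $ q $ b * P $ r $ c * P $ s $ d * \<eta> $ p $ q $ r $ s)"
    by (intro sum.cong refl sum.swap)
  also have "\<dots> = - ?S a b d c"
    unfolding sum_negf[symmetric] by (intro sum.cong refl) (subst assms(3), simp)
  finally show "frame4 P \<eta> $ a $ b $ c $ d = - frame4 P \<eta> $ a $ b $ d $ c"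
    unfolding frame4_nth by simp
qed

lemma raise2_frame:
  assumes "matrix_inv g = P ** minkowski ** transpose P"
  shows "raise2 g A = real_mat P ** (real_mat minkowski ** (transpose (real_mat P) ** A ** real_mat P) **
    real_mat minkowski) ** transpose (real_mat P)"
  by (simp add: raise2_eq assms matrix_transpose_mul real_mat_mult real_mat_transpose[symmetric]
      transpose_minkowski matrix_mul_assoc)

lemma inner2_frame:
  assumes "matrix_inv g = P ** minkowski ** transpose P"
  shows "inner2 g A B = frob (transpose (real_mat P) ** A ** real_mat P)
    (real_mat minkowski ** (transpose (real_mat P) ** B ** real_mat P) ** real_mat minkowski)"
  unfolding inner2_eq raise2_frame[OF assms] frob_congruence ..

lemma trace2_frame:
  assumes "matrix_inv g = P ** minkowski ** transpose P"
  shows "trace2 g A = frob (real_mat minkowski) (transpose (real_mat P) ** A ** real_mat P)"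
proof -
  have "trace2 g A = frob A (real_mat P ** real_mat minkowski ** transpose (real_mat P))"
    by (simp add: trace2_eq assms real_mat_mult real_mat_transpose frob_commute)
  then show ?thesis
    by (simp add: frob_congruence[symmetric] frob_commute)
qed

lemma dot2_frame:
  assumes "matrix_inv g = P ** minkowski ** transpose P"
  shows "transpose (real_mat P) ** dot2 g A B ** real_mat P =
    (transpose (real_mat P) ** A ** real_mat P) ** real_mat minkowski **
    (transpose (real_mat P) ** B ** real_mat P)"
  by (simp add: dot2_eq assms real_mat_mult real_mat_transpose matrix_mul_assoc)

text \<open>Raising \<open>F\<close> contributes the factors of \<open>P\<close> that
  \<open>frob_congruence\<close> moves onto \<eta>; the outer congruence supplies those for its
  first two indices.\<close>

lemma hodge2_frame:
  assumes "matrix_inv g = P ** minkowski ** transpose P"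
  shows "(transpose (real_mat P) ** hodge2 g \<eta> F ** real_mat P) $ a $ b =
    frob (frame4 P \<eta> $ a $ b)
      (real_mat minkowski ** (transpose (real_mat P) ** F ** real_mat P) ** real_mat minkowski) / 2"
  unfolding congruence_nth hodge2_eq raise2_frame[OF assms] frob_congruence[symmetric]
  by (simp add: frame4_def frob_sum_left frob_scaleR_left sum_divide_distrib)
     (simp add: real_mat_def)

lemma cnj2_congruence:
  "cnj2 (transpose (real_mat P) ** A ** real_mat P) = transpose (real_mat P) ** cnj2 A ** real_mat P"
  unfolding vec_eq_iff by (simp add: cnj2_def congruence_nth) (simp add: real_mat_def)

text \<open>Congruence by the inverse of \<open>P\<close> undoes the frame change, so equations
  between frame components carry back to the original basis.\<close>

lemma congruence_cancel:
  fixes A B :: "'a::real_field ^ 4 ^ 4"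
  assumes P: "invertible P"
    and eq: "transpose (real_mat P) ** A ** real_mat P = transpose (real_mat P) ** B ** real_mat P"
  shows "A = B"
proof -
  let ?Q = "real_mat P :: 'a ^ 4 ^ 4" and ?R = "real_mat (matrix_inv P) :: 'a ^ 4 ^ 4"
  have Q: "?Q ** ?R = mat 1"
    by (simp add: real_mat_mult[symmetric] matrix_inv_inverse[OF P] real_mat_one)
  then have Q': "transpose ?R ** transpose ?Q = mat 1"
    by (simp add: matrix_transpose_mul[symmetric])
  have cancel: "transpose ?R ** (transpose ?Q ** C ** ?Q) ** ?R = C" for C :: "'a ^ 4 ^ 4"
  proof -
    have "transpose ?R ** (transpose ?Q ** C ** ?Q) ** ?R = (transpose ?R ** transpose ?Q) ** C ** (?Q ** ?R)"
      by (simp only: matrix_mul_assoc)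
    then show ?thesis by (simp add: Q Q')
  qed
  have "A = transpose ?R ** (transpose ?Q ** A ** ?Q) ** ?R"
    by (rule cancel[symmetric])
  also have "\<dots> = B"
    unfolding eq by (rule cancel)
  finally show ?thesis .
qed

text \<open>All claims are independent of the frame, so they reduce to the Minkowski components
  \<open>X\<close> of \<open>L\<close>. The frame is real, hence conjugation commutes with the
  transport.\<close>

lemma self_dual_dot2_cnj2:
  assumes "lorentzian g" "volume_element g \<eta>" and sd: "sd_bivector g \<eta> L" and "L \<noteq> 0"
  defines "\<Lambda> \<equiv> dot2 g L (cnj2 L)"
  shows "transpose \<Lambda> = \<Lambda>" "trace2 g \<Lambda> = 0" "\<Lambda> \<noteq> 0"
    "null_bivector g L \<Longrightarrow> inner2 g \<Lambda> \<Lambda> = 0"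
proof -
  obtain P where P: "invertible P" "transpose P ** g ** P = minkowski"
    using assms(1) unfolding lorentzian_def by blast
  have G: "matrix_inv g = P ** minkowski ** transpose P" by (rule lorentzian_frame[OF P])
  let ?Q = "real_mat P :: complex ^ 4 ^ 4"
  define X where "X = transpose ?Q ** L ** ?Q"
  have LT: "transpose L = - L" and LH: "hodge2 g \<eta> L = (\<chi> a b. \<i> * L $ a $ b)"
    using sd by (auto simp: sd_bivector_def)
  have minus: "C ** - B = - (C ** B)" "- B ** C = - (B ** C)" for B C :: "complex ^ 4 ^ 4"
    by (simp_all add: matrix_matrix_mult_def vec_eq_iff sum_negf)
  have zero: "B ** 0 = 0" "0 ** B = 0" for B :: "complex ^ 4 ^ 4"
    by (simp_all add: matrix_matrix_mult_def vec_eq_iff)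
  have XT: "transpose X = - X"
    by (simp add: X_def matrix_transpose_mul LT minus matrix_mul_assoc)
  have X0: "X \<noteq> 0"
  proof
    assume "X = 0"
    then have "transpose ?Q ** L ** ?Q = transpose ?Q ** 0 ** ?Q" by (simp only: X_def zero)
    then have "L = 0" by (rule congruence_cancel[OF P(1)])
    with \<open>L \<noteq> 0\<close> show False ..
  qed
  have eta: "\<eta> $ a $ b $ c $ d = - \<eta> $ b $ a $ c $ d" "\<eta> $ a $ b $ c $ d = - \<eta> $ a $ c $ b $ d"
    "\<eta> $ a $ b $ c $ d = - \<eta> $ a $ b $ d $ c" for a b c d
  proof -
    note anti = assms(2)[unfolded volume_element_def, THEN conjunct1, rule_format, of a b c d]
    show "\<eta> $ a $ b $ c $ d = - \<eta> $ b $ a $ c $ d" by (rule anti[THEN conjunct1])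
    show "\<eta> $ a $ b $ c $ d = - \<eta> $ a $ c $ b $ d" by (rule anti[THEN conjunct2, THEN conjunct1])
    show "\<eta> $ a $ b $ c $ d = - \<eta> $ a $ b $ d $ c" by (rule anti[THEN conjunct2, THEN conjunct2])
  qed
  have dual: "\<i> * X $ a $ b = frob (frame4 P \<eta> $ a $ b) (real_mat minkowski ** X ** real_mat minkowski) / 2"
    for a b
  proof -
    have "\<i> * X $ a $ b = (transpose ?Q ** hodge2 g \<eta> L ** ?Q) $ a $ b"
      unfolding LH X_def congruence_nth by (simp add: sum_distrib_left ac_simps)
    then show ?thesis unfolding hodge2_frame[OF G] X_def .
  qed
  obtain t where t: "t * t = -1" "cnj t = - t"
    "X $ 2 $ 3 = t * X $ 0 $ 1" "X $ 3 $ 1 = t * X $ 0 $ 2" "X $ 1 $ 2 = t * X $ 0 $ 3"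
    using minkowski_self_dual_components[OF frame4_antisymmetric[OF eta, of P] XT dual X0] by blast
  note sq = minkowski_self_dual_square[OF t(1,2) XT t(3-5)]
  have frame: "transpose ?Q ** \<Lambda> ** ?Q = X ** real_mat minkowski ** cnj2 X"
    by (simp add: \<Lambda>_def dot2_frame[OF G] X_def cnj2_congruence)
  show "transpose \<Lambda> = \<Lambda>"
  proof (rule congruence_cancel[OF P(1)])
    have "transpose ?Q ** transpose \<Lambda> ** ?Q = transpose (transpose ?Q ** \<Lambda> ** ?Q)"
      by (simp add: matrix_transpose_mul matrix_mul_assoc)
    then show "transpose ?Q ** transpose \<Lambda> ** ?Q = transpose ?Q ** \<Lambda> ** ?Q"
      by (simp add: frame sq(1))
  qed
  show "trace2 g \<Lambda> = 0"
    by (simp add: trace2_frame[OF G] frame sq(2))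
  show "\<Lambda> \<noteq> 0"
  proof
    assume "\<Lambda> = 0"
    then have "X ** real_mat minkowski ** cnj2 X = 0"
      unfolding frame[symmetric] by (simp only: zero)
    with sq(3) X0 show False by blast
  qed
  show "inner2 g \<Lambda> \<Lambda> = 0" if "null_bivector g L"
    using sq(4) that by (simp add: null_bivector_def inner2_frame[OF G] frame X_def[symmetric])
qed

section \<open>Factorisation of the Bel-Robinson tensor\<close>

text \<open>The contraction separates into a factor in \<open>a\<close>, \<open>m\<close> and one in
  \<open>b\<close>, \<open>n\<close>. Antisymmetry of \<open>L\<close> makes each factor the
  negative of an entry of \<open>dot2 g L (cnj2 L)\<close>, and the two signs cancel.\<close>

lemma bel_robinson_square:
  assumes g: "invertible g" "transpose g = g"
    and LT: "transpose L = - L" and W: "sd_weyl g \<eta> W = tensor_prod L L"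
  shows "bel_robinson g \<eta> W = tensor_prod (dot2 g L (cnj2 L)) (dot2 g L (cnj2 L))"
proof -
  have La: "L $ m $ r = - L $ r $ m" for m r
    by (rule antisymmetric_nth[OF LT])
  let ?G = "\<lambda>m n. complex_of_real (matrix_inv g $ m $ n)"
  have "(\<Sum>r\<in>UNIV. \<Sum>s\<in>UNIV. (\<Sum>p\<in>UNIV. \<Sum>q\<in>UNIV. ?G r p * ?G s q * (L $ a $ p * L $ b $ q)) *
        (cnj (L $ m $ r) * cnj (L $ n $ s))) =
      (\<Sum>r\<in>UNIV. \<Sum>p\<in>UNIV. ?G r p * L $ a $ p * cnj (L $ m $ r)) *
      (\<Sum>s\<in>UNIV. \<Sum>q\<in>UNIV. ?G s q * L $ b $ q * cnj (L $ n $ s))" for a b m n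
    unfolding sum_product[of _ UNIV _ UNIV]
    by (intro sum.cong refl) (simp add: sum_product sum_distrib_left sum_distrib_right ac_simps)
  moreover have "(\<Sum>r\<in>UNIV. \<Sum>p\<in>UNIV. ?G r p * L $ a $ p * cnj (L $ m $ r)) =
    - (dot2 g L (cnj2 L) $ a $ m)" for a m
  proof -
    have G: "matrix_inv g $ r $ p = matrix_inv g $ p $ r" for r p
      by (rule matrix_inv_nth_commute[OF g])
    have "(\<Sum>r\<in>UNIV. \<Sum>p\<in>UNIV. ?G r p * L $ a $ p * cnj (L $ m $ r)) =
        (\<Sum>p\<in>UNIV. \<Sum>r\<in>UNIV. ?G r p * L $ a $ p * cnj (L $ m $ r))"
      by (rule sum.swap)
    also have "\<dots> = (\<Sum>p\<in>UNIV. \<Sum>r\<in>UNIV. - (L $ a $ p * ?G p r * cnj (L $ r $ m)))"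
      by (intro sum.cong refl) (subst La, subst G, simp)
    also have "\<dots> = - (dot2 g L (cnj2 L) $ a $ m)"
      by (simp add: dot2_def cnj2_def sum_negf)
    finally show ?thesis .
  qed
  ultimately show ?thesis
    by (simp add: vec_eq_iff bel_robinson_def tensor_prod_def W raise2_def)
qed

section \<open>The rank-one operator and the reality of \<Lambda>\<close>

lemma act_tensor_prod:
  "act g (tensor_prod A B) C = (\<chi> a b. inner2 g C B * A $ a $ b)"
  by (simp add: act_def tensor_prod_def raise2_def inner2_def vec_eq_iff sum_distrib_left
     sum_distrib_right ac_simps)


lemma inner2_scale_left: "inner2 g (\<chi> a b. c * A $ a $ b) B = c * inner2 g A B"
  by (simp add: inner2_def sum_distrib_left mult.assoc)

lemma complex2_inject: "complex2 A = complex2 B \<longleftrightarrow> A = B"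
  by (simp add: complex2_def vec_eq_iff)

lemma inner2_complex2: "inner2 g (complex2 A) (complex2 B) = complex_of_real (inner2 g A B)"
  by (simp add: inner2_def raise2_def complex2_def)

lemma trace2_complex2: "trace2 g (complex2 A) = complex_of_real (trace2 g A)"
  by (simp add: trace2_def complex2_def)

text \<open>Transposition reverses the product, and the signs from the two antisymmetric factors
  cancel. Together with symmetry this makes the product real.\<close>

lemma transpose_dot2_cnj2:
  assumes g: "invertible g" "transpose g = g" and LT: "transpose L = - L"
  shows "transpose (dot2 g L (cnj2 L)) = cnj2 (dot2 g L (cnj2 L))"
proof -
  have La: "L $ m $ r = - L $ r $ m" for m r
    by (rule antisymmetric_nth[OF LT])
  have G: "matrix_inv g $ r $ p = matrix_inv g $ p $ r" for r p
    by (rule matrix_inv_nth_commute[OF g])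
  let ?G = "\<lambda>m n. complex_of_real (matrix_inv g $ m $ n)"
  have "(\<Sum>m\<in>UNIV. \<Sum>n\<in>UNIV. L $ b $ m * ?G m n * cnj (L $ n $ a)) =
      (\<Sum>m\<in>UNIV. \<Sum>n\<in>UNIV. cnj (L $ a $ m) * ?G m n * L $ n $ b)" for a b
  proof -
    have "(\<Sum>m\<in>UNIV. \<Sum>n\<in>UNIV. L $ b $ m * ?G m n * cnj (L $ n $ a)) =
        (\<Sum>n\<in>UNIV. \<Sum>m\<in>UNIV. L $ b $ m * ?G m n * cnj (L $ n $ a))"
      by (rule sum.swap)
    also have "\<dots> = (\<Sum>n\<in>UNIV. \<Sum>m\<in>UNIV. cnj (L $ a $ n) * ?G n m * L $ m $ b)"
      by (intro sum.cong refl) (subst La, subst (2) La, subst G, simp)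
    finally show ?thesis .
  qed
  then show ?thesis
    by (simp add: vec_eq_iff dot2_def cnj2_def transpose_def)
qed

theorem proposition12:
  fixes g :: "real tensor2" and \<eta> W :: "real tensor4" and L :: "complex tensor2"
  assumes "lorentzian g"
    and "volume_element g \<eta>"
    and "weyl_tensor g W"
    and "petrov_type_N g \<eta> W"
    and "sd_bivector g \<eta> L" and "null_bivector g L" and "L \<noteq> 0"
    and "sd_weyl g \<eta> W = tensor_prod L L"
  shows "bel_robinson g \<eta> W = tensor_prod (dot2 g L (cnj2 L)) (dot2 g L (cnj2 L)) \<and>
    {t. eigenvalue_on_ts g (bel_robinson g \<eta> W) t} = {0} \<and>
    (\<exists>\<Lambda> \<in> traceless_symmetric g. complex2 \<Lambda> = dot2 g L (cnj2 L) \<and>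
       real_eigenspace g (bel_robinson g \<eta> W) 0 = {A \<in> traceless_symmetric g. inner2 g \<Lambda> A = 0}) \<and>
    dim (real_eigenspace g (bel_robinson g \<eta> W) 0) = 8"
proof -
  let ?T = "bel_robinson g \<eta> W" and ?L = "dot2 g L (cnj2 L)"
  have g: "invertible g" "transpose g = g"
    using assms(1) lorentzian_frame(1) unfolding lorentzian_def by auto
  have LT: "transpose L = - L" using assms(5) by (simp add: sd_bivector_def)
  note sq = self_dual_dot2_cnj2[OF assms(1,2,5,7)]
  have null: "inner2 g ?L ?L = 0" by (rule sq(4)[OF assms(6)])
  have T: "?T = tensor_prod ?L ?L"
    by (rule bel_robinson_square[OF g LT assms(8)])
  have act: "act g ?T A = (\<chi> a b. inner2 g A ?L * ?L $ a $ b)" for A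
    by (simp add: T act_tensor_prod)
  \<comment> \<open>Taking real parts loses nothing, because the components are shown next to be
    fixed by conjugation.\<close>
  define \<Lambda> :: "real tensor2" where "\<Lambda> = (\<chi> a b. Re (?L $ a $ b))"
  have "cnj2 ?L = ?L"
    using transpose_dot2_cnj2[OF g LT] sq(1) by simp
  then have "cnj2 ?L $ a $ b = ?L $ a $ b" for a b by (simp only:)
  then have "cnj (?L $ a $ b) = ?L $ a $ b" for a b
    by (simp add: cnj2_def)
  then have \<Lambda>: "complex2 \<Lambda> = ?L"
    by (simp add: complex2_def \<Lambda>_def vec_eq_iff complex_eq_iff)
  have \<Lambda>_ts: "\<Lambda> \<in> traceless_symmetric g"
  proof -
    have "complex2 (transpose \<Lambda>) = complex2 \<Lambda>"
      using sq(1) by (simp add: \<Lambda>[symmetric] real_mat_complex[symmetric] real_mat_transpose)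
    moreover have "complex_of_real (trace2 g \<Lambda>) = 0"
      using sq(2) by (simp add: \<Lambda>[symmetric] trace2_complex2)
    ultimately show ?thesis by (simp add: traceless_symmetric_def complex2_inject)
  qed
  have \<Lambda>0: "\<Lambda> \<noteq> 0"
    using sq(3) by (auto simp: \<Lambda>[symmetric] complex2_def vec_eq_iff)
  have "eigenvalue_on_ts g ?T t \<longleftrightarrow> t = 0" for t
  proof
    assume "eigenvalue_on_ts g ?T t"
    then obtain A where A: "A \<noteq> 0" "act g ?T A = (\<chi> a b. t * A $ a $ b)"
      unfolding eigenvalue_on_ts_def by blast
    have e: "inner2 g A ?L * ?L $ a $ b = t * A $ a $ b" for a b
      using A(2) unfolding act by (simp add: vec_eq_iff)
    show "t = 0"
    proof (rule ccontr)
      assume t: "t \<noteq> 0"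
      \<comment> \<open>Pairing the eigenvalue equation with the null tensor \<open>?L\<close> gives
        \<open>t * inner2 g A ?L = 0\<close>; for nonzero \<open>t\<close> the operator then kills
        \<open>A\<close>, which contradicts the equation.\<close>
      have "t * inner2 g A ?L = inner2 g A ?L * inner2 g ?L ?L"
        unfolding inner2_scale_left[symmetric] by (simp only: e)
      then have "inner2 g A ?L = 0" using null t by simp
      then have "A = 0" using e t by (simp add: vec_eq_iff)
      with A(1) show False ..
    qed
  next
    assume t: "t = 0"
    \<comment> \<open>Being null, \<open>?L\<close> is orthogonal to itself and hence an eigenvector
      for 0.\<close>
    have "?L \<in> traceless_symmetric g" using sq(1,2) by (simp add: traceless_symmetric_def)
    moreover have "act g ?T ?L = (\<chi> a b. t * ?L $ a $ b)" by (simp add: act null t)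
    ultimately show "eigenvalue_on_ts g ?T t"
      using sq(3) unfolding eigenvalue_on_ts_def by blast
  qed
  then have ev: "{t. eigenvalue_on_ts g ?T t} = {0}" by auto
  have "act g ?T (complex2 A) = complex2 (0 *\<^sub>R A) \<longleftrightarrow> inner2 g \<Lambda> A = 0" for A
  proof -
    \<comment> \<open>The image is a multiple of the nonzero \<open>?L\<close>, so it vanishes
      exactly when the coefficient does.\<close>
    have "act g ?T (complex2 A) = complex2 (0 *\<^sub>R A) \<longleftrightarrow> inner2 g (complex2 A) ?L = 0"
      using sq(3) by (auto simp: act complex2_def vec_eq_iff)
    also have "\<dots> \<longleftrightarrow> inner2 g A \<Lambda> = 0"
      by (simp add: \<Lambda>[symmetric] inner2_complex2)
    finally show ?thesis using inner2_commute[OF g, of A \<Lambda>] by simp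
  qed
  then have es: "real_eigenspace g ?T 0 = {A \<in> traceless_symmetric g. inner2 g \<Lambda> A = 0}"
    by (auto simp: real_eigenspace_def)
  show ?thesis
    using T ev es \<Lambda> \<Lambda>_ts dim_orthogonal_traceless_symmetric[OF g \<Lambda>_ts \<Lambda>0] by auto
qed

end
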